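(* Let $\pi=m_1B_1\cdots m_tB_t$ be the ltr-min decomposition of a permutation $\pi$. The following are equivalent: \begin{enumerate} \item $B_i$ avoids $213$ and $B_i>B_{i+1}$, for each $i$. \item $\pi$ is $(132,231)$-sortable. \item $\pi\in\mathfrak{S}(1324,2314)$. \end{enumerate} In particular, $\mathrm{Sort}(132,231)=\mathfrak{S}(1324,2314)$.
   Context: A sequence contains a pattern $\tau$ if some subsequence is order isomorphic to $\tau$; otherwise it avoids $\tau$. $\mathfrak{S}(\tau,\tau')$ is the set of permutations avoiding both $\tau$ and $\tau'$. The ltr-min decomposition of $\pi$ is $\pi=m_1B_1m_2B_2\cdots m_tB_t$, where $m_1>\dots>m_t$ are the left-to-right minima of $\pi$ (entries smaller than all preceding entries) and $B_i$ is the (possibly empty) block of entries strictly between $m_i$ and $m_{i+1}$ (following $m_t$, for $i=t$). For consecutive blocks, with $1\le i\le t-1$, the notation $B_i>B_{i+1}$ means that $x>y$ for each $x\in B_i$ and $y\in B_{i+1}$. For a set $\Sigma$ of permutations of length at least $2$, the $\Sigma$-stack acts on an input permutation $\pi=\pi_1\cdots\pi_n$ as follows (starting with empty stack and output). For $i=1,\dots,n$: as long as pushing $\pi_i$ on top of the stack would make the content of the stack, read from top to bottom, contain an occurrence of some $\sigma\in\Sigma$, pop the top element and append it to the output; then push $\pi_i$. After all letters have been pushed, pop all remaining elements, from top to bottom, appending them to the output. The resulting output is denoted $\mathcal{S}^{\Sigma}(\pi)$. The permutation $\pi$ of length $n$ is $\Sigma$-sortable if $\mathcal{S}^{21}(\mathcal{S}^{\Sigma}(\pi))=12\cdots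 n$, where $\mathcal{S}^{21}=\mathcal{S}^{\{21\}}$. For $\Sigma=\{\sigma,\tau\}$ one writes $(\sigma,\tau)$-sortable, and $\mathrm{Sort}(\sigma,\tau)$ for the set of $(\sigma,\tau)$-sortable permutations.
   Formalization: Condition 1 is taken as B_i > B_j for all i < j, not only for consecutive blocks: since blocks may be empty, the literal condition fails, e.g. π = 34215 with blocks (4), (), (5) satisfies it but contains 2314. *)

theory Defs
  imports "HOL-Library.Sublist" "HOL-Combinatorics.Multiset_Permutations"
begin

text \<open>
  A permutation of length \<open>n\<close> is the list of its one-line notation, an arrangement of
  \<open>{1..n}\<close>; the empty permutation is included.
\<close>

definition perms :: "nat list set" where
  "perms = (\<Union>n. permutations_of_set {1..n})"


section \<open>Patterns\<close>

definition order_isomorphic :: "nat list \<Rightarrow> nat list \<Rightarrow> bool" where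
  "order_isomorphic xs ys \<longleftrightarrow>
     length xs = length ys \<and>
     (\<forall>i<length xs. \<forall>j<length xs. xs ! i < xs ! j \<longleftrightarrow> ys ! i < ys ! j)"

definition contains :: "nat list \<Rightarrow> nat list \<Rightarrow> bool" where
  "contains xs \<tau> \<longleftrightarrow> (\<exists>ys. subseq ys xs \<and> order_isomorphic ys \<tau>)"

abbreviation avoids :: "nat list \<Rightarrow> nat list \<Rightarrow> bool" where
  "avoids xs \<tau> \<equiv> \<not> contains xs \<tau>"

definition Av :: "nat list set \<Rightarrow> nat list set" where
  "Av T = {\<pi> \<in> perms. \<forall>\<tau>\<in>T. avoids \<pi> \<tau>}"


section \<open>Left-to-right minima\<close>

definition ltr_minima :: "nat list \<Rightarrow> nat list" where
  "ltr_minima \<pi> = map ((!) \<pi>) (filter (\<lambda>i. \<forall>j<i. \<pi> ! i < \<pi> ! j) [0..<length \<pi>])"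

text \<open>
  \<open>ltr_min_decomp \<pi> ms Bs\<close>: with \<open>ms = [m\<^sub>1, \<dots>, m\<^sub>t]\<close> and \<open>Bs = [B\<^sub>1, \<dots>, B\<^sub>t]\<close>, the ltr-min
  decomposition of \<open>\<pi>\<close> is \<open>m\<^sub>1 B\<^sub>1 \<dots> m\<^sub>t B\<^sub>t\<close>.  As the letters of a permutation are distinct, this
  determines the blocks; existence and uniqueness are shown below.
\<close>

definition ltr_min_decomp :: "nat list \<Rightarrow> nat list \<Rightarrow> nat list list \<Rightarrow> bool" where
  "ltr_min_decomp \<pi> ms Bs \<longleftrightarrow>
     ms = ltr_minima \<pi> \<and> length Bs = length ms \<and> \<pi> = concat (map2 (#) ms Bs)"

definition block_gt :: "nat list \<Rightarrow> nat list \<Rightarrow> bool" where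
  "block_gt B C \<longleftrightarrow> (\<forall>x\<in>set B. \<forall>y\<in>set C. x > y)"

text \<open>
  The chain \<open>B\<^sub>1 > B\<^sub>2 > \<dots> > B\<^sub>t\<close> has to be read as \<open>B\<^sub>i > B\<^sub>j\<close> for all \<open>i < j\<close>.  Blocks may be empty,
  so \<open>>\<close> is not transitive on blocks, and comparing only neighbours would say nothing about two
  nonempty blocks separated by an empty one; see \<open>neighbouring_blocks_insufficient\<close> below.
\<close>

definition blocks_decreasing :: "nat list list \<Rightarrow> bool" where
  "blocks_decreasing Bs \<longleftrightarrow>
     (\<forall>i j. i < j \<and> j < length Bs \<longrightarrow> block_gt (Bs ! i) (Bs ! j))"

lemma ltr_minima_snoc:
  "ltr_minima (xs @ [x]) = ltr_minima xs @ (if \<forall>y\<in>set xs. x < y then [x] else [])"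
proof -
  let ?P = "\<lambda>ys i. \<forall>j<i. ys ! i < (ys ! j :: nat)"
  have f: "filter (?P (xs @ [x])) [0..<length xs] = filter (?P xs) [0..<length xs]"
    by (rule filter_cong) (auto simp: nth_append)
  have m: "map ((!) (xs @ [x])) (filter (?P xs) [0..<length xs])
         = map ((!) xs) (filter (?P xs) [0..<length xs])"
    by (rule map_cong) (auto simp: nth_append)
  have l: "?P (xs @ [x]) (length xs) \<longleftrightarrow> (\<forall>y\<in>set xs. x < y)"
    by (auto simp: nth_append all_set_conv_all_nth)
  show ?thesis
    unfolding ltr_minima_def using f m l by auto
qed

lemma ltr_min_decomp_exists: "\<exists>ms Bs. ltr_min_decomp \<pi> ms Bs"
proof (induction \<pi> rule: rev_induct)
  case Nil
  show ?case by (simp add: ltr_min_decomp_def ltr_minima_def)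
next
  case (snoc x xs)
  then obtain ms Bs where "ltr_min_decomp xs ms Bs" by blast
  then have d: "ltr_minima xs = ms" "length Bs = length ms" "concat (map2 (#) ms Bs) = xs"
    unfolding ltr_min_decomp_def by metis+
  show ?case
  proof (cases "\<forall>y\<in>set xs. x < y")
    case True
    have "ltr_min_decomp (xs @ [x]) (ms @ [x]) (Bs @ [[]])"
      unfolding ltr_min_decomp_def ltr_minima_snoc using True d by simp
    then show ?thesis by blast
  next
    case False
    then have "ms \<noteq> []" using d(3) by force
    then have ne: "Bs \<noteq> []" using d(2) by auto
    obtain ms' m where ms: "ms = ms' @ [m]" using \<open>ms \<noteq> []\<close> by (metis rev_exhaust)
    obtain Bs' B where Bs: "Bs = Bs' @ [B]" using ne by (metis rev_exhaust)
    have len: "length Bs' = length ms'" using d(2) ms Bs by simp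
    have "ltr_min_decomp (xs @ [x]) ms (Bs' @ [B @ [x]])"
      using False d len unfolding ltr_min_decomp_def ltr_minima_snoc ms Bs by auto
    then show ?thesis by blast
  qed
qed

lemma ltr_min_decomp_unique:
  assumes "distinct \<pi>" "ltr_min_decomp \<pi> ms Bs" "ltr_min_decomp \<pi> ms' Bs'"
  shows "ms = ms' \<and> Bs = Bs'"
proof -
  have "Bs = Bs'"
    if "distinct (concat (map2 (#) ms Bs))" "length Bs = length ms" "length Bs' = length ms"
      "concat (map2 (#) ms Bs) = concat (map2 (#) ms Bs')" for ms :: "nat list" and Bs Bs'
    using that
  proof (induction ms arbitrary: Bs Bs')
    case Nil
    then show ?case by simp
  next
    case (Cons m ms)
    obtain B Cs where B: "Bs = B # Cs" using Cons.prems(2) by (cases Bs) auto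
    obtain B' Cs' where B': "Bs' = B' # Cs'" using Cons.prems(3) by (cases Bs') auto
    have eq: "B @ concat (map2 (#) ms Cs) = B' @ concat (map2 (#) ms Cs')"
      using Cons.prems(4) B B' by simp
    have dist: "distinct (B @ concat (map2 (#) ms Cs))"
      using Cons.prems(1) B by simp
    have len: "length Cs = length ms" "length Cs' = length ms"
      using Cons.prems(2,3) B B' by auto
    have "B = B' \<and> concat (map2 (#) ms Cs) = concat (map2 (#) ms Cs')"
    proof (cases ms)
      case Nil
      then show ?thesis using eq by simp
    next
      case (Cons k ks)
      obtain D Ds where "Cs = D # Ds" using len Cons by (cases Cs) auto
      moreover obtain D' Ds' where "Cs' = D' # Ds'" using len Cons by (cases Cs') auto
      ultimately obtain r r' where r: "concat (map2 (#) ms Cs) = k # r"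
        "concat (map2 (#) ms Cs') = k # r'"
        using Cons by simp
      have "k \<notin> set B \<and> k \<notin> set r" using dist r by auto
      then show ?thesis using eq r append_Cons_eq_iff[of k B r B' r'] by simp
    qed
    then show ?case using Cons.IH[of Cs Cs'] dist len B B' by simp
  qed
  then show ?thesis using assms unfolding ltr_min_decomp_def by metis
qed

lemma neighbouring_blocks_insufficient:
  defines "Bs \<equiv> [[4], [], [5]]"
  shows "ltr_min_decomp [3,4,2,1,5] [3,2,1] Bs"
    and "\<forall>B\<in>set Bs. avoids B [2,1,3]"
    and "\<forall>i. Suc i < length Bs \<longrightarrow> block_gt (Bs ! i) (Bs ! Suc i)"
    and "contains [3,4,2,1,5] [2,3,1,4]"
proof -
  have "ltr_minima [3,4,2,1,5] = [3,2,1]" by code_simp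
  then show "ltr_min_decomp [3,4,2,1,5] [3,2,1] Bs"
    by (simp add: ltr_min_decomp_def Bs_def)
  have "avoids B [2,1,3]" if "length B < 3" for B
  proof
    assume "contains B [2,1,3]"
    then obtain ys where "subseq ys B" "length ys = length [2,1,3::nat]"
      unfolding contains_def order_isomorphic_def by blast
    then show False using that list_emb_length[of "(=)" ys B] by simp
  qed
  then show "\<forall>B\<in>set Bs. avoids B [2,1,3]"
    by (simp add: Bs_def)
  show "\<forall>i. Suc i < length Bs \<longrightarrow> block_gt (Bs ! i) (Bs ! Suc i)"
    by (simp add: Bs_def block_gt_def nth_Cons split: nat.split)
  have "subseq [3,4,2,5] [3,4,2,1,5::nat]" by simp
  moreover have "order_isomorphic [3,4,2,5] [2,3,1,4]" by code_simp
  ultimately show "contains [3,4,2,1,5] [2,3,1,4]"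
    unfolding contains_def by (intro exI conjI)
qed


section \<open>Pattern-avoiding stacks\<close>

text \<open>
  \<open>stack_run \<Sigma> xs s\<close> is the remaining output of the \<open>\<Sigma>\<close>-stack when \<open>xs\<close> is the remaining input
  and \<open>s\<close> the current stack, read from top to bottom.  The second equation pushes onto the empty
  stack unconditionally: patterns in \<open>\<Sigma>\<close> have length at least 2, so a single letter contains none.
\<close>

fun stack_run :: "nat list set \<Rightarrow> nat list \<Rightarrow> nat list \<Rightarrow> nat list" where
  "stack_run \<Sigma> [] s = s"
| "stack_run \<Sigma> (x # xs) [] = stack_run \<Sigma> xs [x]"
| "stack_run \<Sigma> (x # xs) (y # s) =
     (if \<exists>\<sigma>\<in>\<Sigma>. contains (x # y # s) \<sigma>
      then y # stack_run \<Sigma> (x # xs) s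
      else stack_run \<Sigma> xs (x # y # s))"

definition stack_output :: "nat list set \<Rightarrow> nat list \<Rightarrow> nat list" where
  "stack_output \<Sigma> \<pi> = stack_run \<Sigma> \<pi> []"

definition sortable :: "nat list set \<Rightarrow> nat list \<Rightarrow> bool" where
  "sortable \<Sigma> \<pi> \<longleftrightarrow> stack_output {[2,1]} (stack_output \<Sigma> \<pi>) = [1..<Suc (length \<pi>)]"

definition Sort :: "nat list \<Rightarrow> nat list \<Rightarrow> nat list set" where
  "Sort \<sigma> \<tau> = {\<pi> \<in> perms. sortable {\<sigma>, \<tau>} \<pi>}"

end

theory Submission
  imports Defs
begin

text \<open>
  A word with distinct letters avoids both \<open>132\<close> and \<open>231\<close> exactly if it first decreases and then
  increases, so this is the shape that the \<open>{132, 231}\<close>-stack keeps its content in, read from top to bottom.  On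
  \<open>\<pi> = m\<^sub>1 B\<^sub>1 \<dots> m\<^sub>t B\<^sub>t\<close> the increasing part consists of the minima \<open>m\<^sub>i, \<dots>, m\<^sub>1\<close> seen so far, which
  stay at the bottom of the stack until the end of the input.
  The decreasing part above them holds letters of the current block \<open>B\<^sub>i\<close> and is treated as by a
  stack that pops whatever is larger than the incoming letter, that is, by the \<open>12\<close>-stack; the
  next minimum pops all of it.  Hence the output is
  \<open>W m\<^sub>t \<dots> m\<^sub>1\<close> with \<open>W = S(B\<^sub>1) \<dots> S(B\<^sub>t)\<close>, where \<open>S\<close> is the \<open>12\<close>-stack
  (\<open>stack_run_concat_blocks\<close>).

  By Knuth's theorem the \<open>21\<close>-stack sorts this output if and only if it avoids \<open>231\<close>.  As \<open>m\<^sub>t\<close> is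
  smaller than all of \<open>W\<close> and the minima at the end increase, this means that \<open>W\<close> is decreasing:
  each \<open>S(B\<^sub>i)\<close> decreases, and \<open>B\<^sub>i > B\<^sub>j\<close> for \<open>i < j\<close>.  Knuth's theorem for the reversed order
  says that \<open>S(B)\<close> decreases if and only if \<open>B\<close> avoids \<open>213\<close>.  Both uses of Knuth's theorem are
  instances of \<open>sorted_wrt_order_stack_iff\<close>, which is stated for an arbitrary strict total order.

  The link between the condition on blocks and the two patterns of length four involves no stack.
  Together \<open>1324\<close> and \<open>2314\<close> ask for letters \<open>x y z w\<close> in this order of position with
  \<open>x, z < y < w\<close>.  Then \<open>y\<close> and \<open>w\<close> are not minima.  If they lie in one block, so does \<open>z\<close>, and
  \<open>y z w\<close> is a \<open>213\<close>; otherwise \<open>y < w\<close> shows that the two blocks are in the wrong order.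
  Conversely, the minimum in front of the block of \<open>y\<close> serves as \<open>x\<close>, and in the second case the
  minimum in front of the block of \<open>w\<close> serves as \<open>z\<close> (\<open>four_letters_iff_blocks\<close>).
\<close>

section \<open>Subsequences and patterns of bounded length\<close>

lemma subseq2_Cons:
  "subseq [a, b] (x # xs) \<longleftrightarrow> a = x \<and> b \<in> set xs \<or> subseq [a, b] xs"
  by (auto simp: subseq_singleton_left dest: subseq_Cons')

lemma subseq3_Cons:
  "subseq [a, b, c] (x # xs) \<longleftrightarrow> a = x \<and> subseq [b, c] xs \<or> subseq [a, b, c] xs"
  by (auto dest: subseq_Cons')

lemma subseq4_Cons:
  "subseq [a, b, c, d] (x # xs) \<longleftrightarrow> a = x \<and> subseq [b, c, d] xs \<or> subseq [a, b, c, d] xs"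
  by (auto dest: subseq_Cons')

lemma ex_append_eq_Cons:
  "(\<exists>us vs. x # xs = us @ vs \<and> P us vs) \<longleftrightarrow>
     P [] (x # xs) \<or> (\<exists>us vs. xs = us @ vs \<and> P (x # us) vs)"
  by (auto simp: Cons_eq_append_conv)

lemma subseq2_append:
  "subseq [a, b] (ys @ zs) \<longleftrightarrow>
     subseq [a, b] zs \<or> (a \<in> set ys \<and> b \<in> set zs) \<or> subseq [a, b] ys"
  unfolding subseq_append_iff ex_append_eq_Cons by (simp add: subseq_singleton_left)

lemma subseq3_append:
  "subseq [a, b, c] (ys @ zs) \<longleftrightarrow>
     subseq [a, b, c] zs \<or> (a \<in> set ys \<and> subseq [b, c] zs) \<or>
     (subseq [a, b] ys \<and> c \<in> set zs) \<or> subseq [a, b, c] ys"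
  unfolding subseq_append_iff ex_append_eq_Cons by (simp add: subseq_singleton_left)

lemma subseq4_append:
  "subseq [a, b, c, d] (ys @ zs) \<longleftrightarrow>
     subseq [a, b, c, d] zs \<or> (a \<in> set ys \<and> subseq [b, c, d] zs) \<or>
     (subseq [a, b] ys \<and> subseq [c, d] zs) \<or> (subseq [a, b, c] ys \<and> d \<in> set zs) \<or>
     subseq [a, b, c, d] ys"
  unfolding subseq_append_iff ex_append_eq_Cons by (simp add: subseq_singleton_left)

lemma subseq_append_leftD: "subseq (us @ vs) xs \<Longrightarrow> subseq us xs"
  by (rule subseq_order.trans[of _ "us @ vs"]) auto

lemma distinct_if_subseq: "subseq xs ys \<Longrightarrow> distinct ys \<Longrightarrow> distinct xs"
  by (metis in_set_subseqs subseqs_distinctD)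

lemma sorted_wrt_iff_subseq:
  "sorted_wrt P xs \<longleftrightarrow> (\<forall>a b. subseq [a, b] xs \<longrightarrow> P a b)"
  by (induction xs) (auto simp: subseq2_Cons subseq_singleton_left simp del: subseq_Cons2_iff)

lemma contains_length2:
  "contains xs [p, q] \<longleftrightarrow> (\<exists>a b. subseq [a, b] xs \<and> order_isomorphic [a, b] [p, q])"
proof
  assume "contains xs [p, q]"
  then obtain ys where ys: "subseq ys xs" "order_isomorphic ys [p, q]"
    unfolding contains_def by blast
  then have "length ys = Suc (Suc 0)" by (simp add: order_isomorphic_def)
  then obtain a b where "ys = [a, b]" by (auto simp: length_Suc_conv)
  with ys show "\<exists>a b. subseq [a, b] xs \<and> order_isomorphic [a, b] [p, q]" by blast
qed (auto simp: contains_def)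

lemma contains_length3:
  "contains xs [p, q, r] \<longleftrightarrow>
     (\<exists>a b c. subseq [a, b, c] xs \<and> order_isomorphic [a, b, c] [p, q, r])"
proof
  assume "contains xs [p, q, r]"
  then obtain ys where ys: "subseq ys xs" "order_isomorphic ys [p, q, r]"
    unfolding contains_def by blast
  then have "length ys = Suc (Suc (Suc 0))" by (simp add: order_isomorphic_def)
  then obtain a b c where "ys = [a, b, c]" by (auto simp: length_Suc_conv)
  with ys show "\<exists>a b c. subseq [a, b, c] xs \<and> order_isomorphic [a, b, c] [p, q, r]" by blast
qed (auto simp: contains_def)

lemma contains_length4:
  "contains xs [p, q, r, t] \<longleftrightarrow>
     (\<exists>a b c d. subseq [a, b, c, d] xs \<and> order_isomorphic [a, b, c, d] [p, q, r, t])"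
proof
  assume "contains xs [p, q, r, t]"
  then obtain ys where ys: "subseq ys xs" "order_isomorphic ys [p, q, r, t]"
    unfolding contains_def by blast
  then have "length ys = Suc (Suc (Suc (Suc 0)))" by (simp add: order_isomorphic_def)
  then obtain a b c d where "ys = [a, b, c, d]" by (auto simp: length_Suc_conv)
  with ys show "\<exists>a b c d. subseq [a, b, c, d] xs \<and> order_isomorphic [a, b, c, d] [p, q, r, t]"
    by blast
qed (auto simp: contains_def)

lemmas order_isomorphic_simps = order_isomorphic_def All_less_Suc2 eval_nat_numeral

lemma contains_21: "contains xs [2, 1] \<longleftrightarrow> (\<exists>a b. subseq [a, b] xs \<and> b < a)"
proof -
  have "order_isomorphic [a, b] [2, 1] \<longleftrightarrow> b < a" for a b
    by (auto simp: order_isomorphic_simps)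
  then show ?thesis unfolding contains_length2 by blast
qed

lemma contains_213:
  "contains xs [2, 1, 3] \<longleftrightarrow> (\<exists>b a c. subseq [b, a, c] xs \<and> a < b \<and> b < c)"
proof -
  have "order_isomorphic [b, a, c] [2, 1, 3] \<longleftrightarrow> a < b \<and> b < c" for b a c
    by (auto simp: order_isomorphic_simps)
  then show ?thesis unfolding contains_length3 by blast
qed

text \<open>
  The two patterns differ only in the order of the outer letters; their union is an interior
  peak.
\<close>

lemma contains_132_or_231:
  assumes "distinct xs"
  shows "contains xs [1, 3, 2] \<or> contains xs [2, 3, 1] \<longleftrightarrow>
     (\<exists>a b c. subseq [a, b, c] xs \<and> a < b \<and> c < b)"
proof -
  have "order_isomorphic [a, b, c] [1, 3, 2] \<longleftrightarrow> a < c \<and> c < b"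
       "order_isomorphic [a, b, c] [2, 3, 1] \<longleftrightarrow> c < a \<and> a < b" for a b c
    by (auto simp: order_isomorphic_simps)
  moreover have "a \<noteq> c" if "subseq [a, b, c] xs" for a b c
    using distinct_if_subseq[OF that assms] by simp
  ultimately show ?thesis
    unfolding contains_length3 by (meson linorder_neqE_nat order_less_trans)
qed

text \<open>
  Likewise, the union of these patterns leaves the order of the first and third letter open.
\<close>

lemma contains_1324_or_2314:
  assumes "distinct xs"
  shows "contains xs [1, 3, 2, 4] \<or> contains xs [2, 3, 1, 4] \<longleftrightarrow>
     (\<exists>x y z w. subseq [x, y, z, w] xs \<and> x < y \<and> z < y \<and> y < w)"
proof -
  have "order_isomorphic [x, y, z, w] [1, 3, 2, 4] \<longleftrightarrow> x < z \<and> z < y \<and> y < w"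
       "order_isomorphic [x, y, z, w] [2, 3, 1, 4] \<longleftrightarrow> z < x \<and> x < y \<and> y < w" for x y z w
    by (auto simp: order_isomorphic_simps)
  moreover have "x \<noteq> z" if "subseq [x, y, z, w] xs" for x y z w
    using distinct_if_subseq[OF that assms] by simp
  ultimately show ?thesis
    unfolding contains_length4 by (meson linorder_neqE_nat order_less_trans)
qed


section \<open>Stacks that keep their content sorted\<close>

text \<open>
  For \<open>R = (<)\<close> this is the \<open>21\<close>-stack and for \<open>R = (>)\<close> the \<open>12\<close>-stack: the content is kept
  \<open>R\<close>-increasing from top to bottom, so comparing the new letter with the top element suffices.
\<close>

fun order_stack :: "('a \<Rightarrow> 'a \<Rightarrow> bool) \<Rightarrow> 'a list \<Rightarrow> 'a list \<Rightarrow> 'a list" where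
  "order_stack R [] s = s"
| "order_stack R (x # xs) [] = order_stack R xs [x]"
| "order_stack R (x # xs) (y # s) =
     (if R y x then y # order_stack R (x # xs) s else order_stack R xs (x # y # s))"

lemma mset_order_stack: "mset (order_stack R xs s) = mset xs + mset s"
  by (induction R xs s rule: order_stack.induct) auto

lemma set_order_stack: "set (order_stack R xs s) = set xs \<union> set s"
  using mset_order_stack[of R xs s] by (metis set_mset_mset set_mset_union)

text \<open>
  Knuth's theorem.  The generalization to a nonempty stack treats its letters, from bottom to top,
  as if they were the next letters of the input: they form an \<open>R\<close>-decreasing word, which the
  machine pushes without popping anything.  Pushing a letter therefore leaves the word
  \<open>rev s @ xs\<close> unchanged.  Popping \<open>y\<close> because of \<open>x\<close> spoils the output exactly if some later
  letter \<open>z\<close> precedes \<open>y\<close> in the order, which makes \<open>y x z\<close> the forbidden pattern.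
\<close>

lemma sorted_wrt_order_stack_iff:
  assumes "transp R" "asymp R" "totalp R" "sorted_wrt R s" "distinct (s @ xs)"
  shows "sorted_wrt R (order_stack R xs s) \<longleftrightarrow>
     (\<nexists>b c a. subseq [b, c, a] (rev s @ xs) \<and> R a b \<and> R b c)"
  using assms
proof (induction R xs s rule: order_stack.induct)
  case (1 R s)
  have "R b a" if "subseq [a, b, c] (rev s)" for a b c
  proof -
    have "subseq [a, b] (rev s)" using that subseq_append_leftD[of "[a, b]" "[c]"] by simp
    moreover have "sorted_wrt (\<lambda>x y. R y x) (rev s)" using 1 by (simp add: sorted_wrt_rev)
    ultimately show ?thesis unfolding sorted_wrt_iff_subseq by blast
  qed
  then show ?case using 1 by (auto dest: asympD)
next
  case (2 R x xs)
  then show ?case by simp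
next
  case (3 R x xs y s)
  show ?case
  proof (cases "R y x")
    case True
    have desc: "R b a" if "subseq [a, b] (rev s)" for a b
    proof -
      have "sorted_wrt (\<lambda>x y. R y x) (rev s)" using 3 by (simp add: sorted_wrt_rev)
      then show ?thesis using that unfolding sorted_wrt_iff_subseq by blast
    qed
    have y: "R y b" if "b \<in> set s" for b using that 3 by simp
    have yz: "R y z \<longleftrightarrow> \<not> R z y" if "z \<in> set xs" for z
    proof -
      have "y \<noteq> z" using that 3 by auto
      then show ?thesis using totalpD[OF \<open>totalp R\<close>, of y z] asympD[OF \<open>asymp R\<close>] by blast
    qed
    have "sorted_wrt R (order_stack R (x # xs) (y # s)) \<longleftrightarrow>
        (\<forall>z\<in>set xs. \<not> R z y) \<and> sorted_wrt R (order_stack R (x # xs) s)"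
      using True y yz by (auto simp: set_order_stack)
    also have "\<dots> \<longleftrightarrow> (\<forall>z\<in>set xs. \<not> R z y) \<and>
        (\<nexists>b c a. subseq [b, c, a] (rev s @ x # xs) \<and> R a b \<and> R b c)"
      using 3 True by auto
    also have "\<dots> \<longleftrightarrow> (\<nexists>b c a. subseq [b, c, a] (rev s @ y # x # xs) \<and> R a b \<and> R b c)"
    proof -
      have 1: "\<exists>b c a. subseq [b, c, a] (rev s @ y # x # xs) \<and> R a b \<and> R b c"
        if "z \<in> set xs" "R z y" for z
      proof -
        have "subseq [y, x, z] (rev s @ y # x # xs)"
          using that by (simp add: subseq3_append subseq_singleton_left)
        then show ?thesis using that True by blast
      qed
      have 2: "subseq [b, c, a] (rev s @ x # xs) \<or> (\<exists>z\<in>set xs. R z y)"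
        if sub: "subseq [b, c, a] (rev s @ y # x # xs)" and R: "R a b" "R b c" for b c a
      proof -
        \<comment> \<open>As rev s is R-decreasing, y cannot be the last letter of an occurrence.\<close>
        have "\<not> subseq [b, c] (rev s)" using desc R \<open>asymp R\<close> by (blast dest: asympD)
        then consider "subseq [b, c, a] (rev s @ x # xs)"
          | "b \<in> set s" "c = y" | "b = y" "subseq [c, a] (x # xs)"
          using sub unfolding subseq3_append subseq3_Cons[of _ _ _ y] subseq2_Cons[of _ _ y]
          unfolding set_rev by blast
        then show ?thesis
        proof cases
          case 2
          then show ?thesis using y R \<open>asymp R\<close> by (blast dest: asympD)
        next
          case 3
          then have "a \<in> set (x # xs)" using subseq_Cons' subseq_singleton_left by metis
          then show ?thesis using 3 True R \<open>asymp R\<close> by (auto dest: asympD)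
        qed simp
      qed
      have 3: "subseq [b, c, a] (rev s @ y # x # xs)" if "subseq [b, c, a] (rev s @ x # xs)" for b c a
        using that unfolding subseq3_append subseq3_Cons[of _ _ _ y] subseq2_Cons[of _ _ y] by auto
      have "(\<exists>b c a. subseq [b, c, a] (rev s @ y # x # xs) \<and> R a b \<and> R b c) \<longleftrightarrow>
        (\<exists>z\<in>set xs. R z y) \<or> (\<exists>b c a. subseq [b, c, a] (rev s @ x # xs) \<and> R a b \<and> R b c)"
        (is "?L \<longleftrightarrow> ?M \<or> ?N")
      proof
        assume ?L
        then obtain b c a where p: "subseq [b, c, a] (rev s @ y # x # xs)" "R a b" "R b c" by blast
        show "?M \<or> ?N" using 2[OF p] p(2,3) by blast
      next
        assume "?M \<or> ?N"
        then show ?L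
        proof
          assume ?M
          then show ?L using 1 by blast
        next
          assume ?N
          then obtain b c a where p: "subseq [b, c, a] (rev s @ x # xs)" "R a b" "R b c" by blast
          show ?L using 3[OF p(1)] p(2,3) by blast
        qed
      qed
      then show ?thesis by blast
    qed
    finally show ?thesis by simp
  next
    case False
    then have "R x y" using 3 by (auto dest: totalpD)
    moreover have "R x z" if "z \<in> set s" for z
      using \<open>R x y\<close> 3 that by (auto dest: transpD)
    ultimately show ?thesis using 3 False by auto
  qed
qed

lemma stack_run_21:
  assumes "sorted_wrt (<) s" "distinct (s @ xs)"
  shows "stack_run {[2, 1]} xs s = order_stack (<) xs s"
  using assms
proof (induction "(<) :: nat \<Rightarrow> nat \<Rightarrow> bool" xs s rule: order_stack.induct)
  case (3 x xs y s)
  have inc: "a < b" if "subseq [a, b] (y # s)" for a b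
    using that \<open>sorted_wrt (<) (y # s)\<close> unfolding sorted_wrt_iff_subseq by blast
  have "contains (x # y # s) [2, 1] \<longleftrightarrow> (\<exists>b\<in>set (y # s). b < x)"
    unfolding contains_21 subseq2_Cons[of _ _ x] using inc less_asym by blast
  also have "\<dots> \<longleftrightarrow> y < x"
    using 3(3) by auto
  finally have "contains (x # y # s) [2, 1] \<longleftrightarrow> y < x" .
  moreover have "y \<noteq> x" using 3(4) by auto
  moreover have "sorted_wrt (<) (x # y # s)" if "\<not> y < x"
    using that 3(3) \<open>y \<noteq> x\<close> by auto
  ultimately show ?case using 3 by (cases "y < x") simp_all
qed simp_all

lemma stack_output_21: "distinct xs \<Longrightarrow> stack_output {[2, 1]} xs = order_stack (<) xs []"
  unfolding stack_output_def by (rule stack_run_21) auto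

lemma stack_output_21_sorted_iff:
  assumes "distinct xs"
  shows "sorted_wrt (<) (stack_output {[2, 1]} xs) \<longleftrightarrow>
     (\<nexists>b c a. subseq [b, c, a] xs \<and> a < b \<and> b < c)"
proof -
  have "sorted_wrt (<) (order_stack (<) xs []) \<longleftrightarrow>
      (\<nexists>b c a. subseq [b, c, a] (rev [] @ xs) \<and> a < b \<and> b < c)"
    using assms by (intro sorted_wrt_order_stack_iff) auto
  then show ?thesis unfolding stack_output_21[OF assms] by simp
qed

lemma order_stack_decreasing_iff:
  assumes "distinct B"
  shows "sorted_wrt (>) (order_stack (>) B []) \<longleftrightarrow> avoids B [2, 1, 3]"
proof -
  have "sorted_wrt (>) (order_stack (>) B []) \<longleftrightarrow>
      (\<nexists>b c a. subseq [b, c, a] (rev [] @ B) \<and> a > b \<and> b > c)"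
    using assms by (intro sorted_wrt_order_stack_iff) auto
  then show ?thesis unfolding contains_213 by auto
qed


section \<open>Blocks between left-to-right minima\<close>

text \<open>
  What the arguments below need of a decomposition into minima and blocks, in a form suited to
  induction on the first block.
\<close>

definition ltr_min_shape :: "nat list \<Rightarrow> nat list list \<Rightarrow> bool" where
  "ltr_min_shape ms Bs \<longleftrightarrow> sorted_wrt (>) ms \<and> list_all2 (\<lambda>m B. \<forall>x\<in>set B. m < x) ms Bs"

lemma ltr_min_shape_induct [consumes 1, case_names Nil Cons]:
  assumes "ltr_min_shape ms Bs" "P [] []"
    and "\<And>m B ms Bs. ltr_min_shape ms Bs \<Longrightarrow> \<forall>m'\<in>set ms. m' < m \<Longrightarrow> \<forall>x\<in>set B. m < x \<Longrightarrow>
      P ms Bs \<Longrightarrow> P (m # ms) (B # Bs)"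
  shows "P ms Bs"
proof -
  have "list_all2 (\<lambda>m B. \<forall>x\<in>set B. m < x) ms Bs" "sorted_wrt (>) ms"
    using assms(1) by (auto simp: ltr_min_shape_def)
  then show ?thesis
    by (induction rule: list_all2_induct) (auto intro!: assms(2,3) simp: ltr_min_shape_def)
qed

lemma set_concat_map2_Cons:
  "length ms = length Bs \<Longrightarrow> set (concat (map2 (#) ms Bs)) = set ms \<union> (\<Union>B\<in>set Bs. set B)"
  by (induction ms Bs rule: list_induct2) auto

lemma sorted_wrt_concat:
  "sorted_wrt P (concat xss) \<longleftrightarrow>
     (\<forall>xs\<in>set xss. sorted_wrt P xs) \<and> sorted_wrt (\<lambda>xs ys. \<forall>x\<in>set xs. \<forall>y\<in>set ys. P x y) xss"
  by (induction xss) (auto simp: sorted_wrt_append)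

lemma blocks_decreasing_iff_sorted_wrt: "blocks_decreasing Bs \<longleftrightarrow> sorted_wrt block_gt Bs"
  unfolding blocks_decreasing_def sorted_wrt_iff_nth_less by blast

text \<open>
  The existence proof by appending letters at the end is repeated with the shape as an additional
  invariant; uniqueness of the decomposition then transfers the shape to the given one.
\<close>

lemma ltr_min_shape_if_ltr_min_decomp:
  assumes "ltr_min_decomp \<pi> ms Bs" "distinct \<pi>"
  shows "ltr_min_shape ms Bs"
proof -
  have "\<exists>ms Bs. ltr_min_decomp \<pi> ms Bs \<and> ltr_min_shape ms Bs"
    using assms(2)
  proof (induction \<pi> rule: rev_induct)
    case Nil
    then show ?case by (simp add: ltr_min_decomp_def ltr_minima_def ltr_min_shape_def)
  next
    case (snoc x xs)
    then obtain ms Bs where "ltr_min_decomp xs ms Bs" and hb: "ltr_min_shape ms Bs" by auto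
    then have d: "ltr_minima xs = ms" "length Bs = length ms" "concat (map2 (#) ms Bs) = xs"
      unfolding ltr_min_decomp_def by metis+
    have set_xs: "set xs = set ms \<union> (\<Union>B\<in>set Bs. set B)"
      using set_concat_map2_Cons[of ms Bs] d by simp
    show ?case
    proof (cases "\<forall>y\<in>set xs. x < y")
      case True
      have "ltr_min_decomp (xs @ [x]) (ms @ [x]) (Bs @ [[]])"
        unfolding ltr_min_decomp_def ltr_minima_snoc using True d by simp
      moreover have "ltr_min_shape (ms @ [x]) (Bs @ [[]])"
        using hb True set_xs by (auto simp: ltr_min_shape_def sorted_wrt_append list_all2_appendI)
      ultimately show ?thesis by blast
    next
      case False
      then obtain y where y: "y \<in> set xs" "y < x"
        using snoc.prems by (auto simp: not_less le_less)
      have "ms \<noteq> []" using y d by auto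
      then obtain ms' m where ms: "ms = ms' @ [m]" by (metis rev_exhaust)
      then have "Bs \<noteq> []" using d by auto
      then obtain Bs' B where Bs: "Bs = Bs' @ [B]" by (metis rev_exhaust)
      have len: "length Bs' = length ms'" using d(2) ms Bs by simp
      have "ltr_min_decomp (xs @ [x]) ms (Bs' @ [B @ [x]])"
        using False d len unfolding ltr_min_decomp_def ltr_minima_snoc ms Bs by auto
      moreover have "ltr_min_shape ms (Bs' @ [B @ [x]])"
      proof -
        \<comment> \<open>No letter read so far is smaller than the last minimum, since each of them is bounded
             below by some minimum.\<close>
        obtain m' where m': "m' \<in> set ms" "m' \<le> y"
          using y set_xs hb by (auto simp: ltr_min_shape_def list_all2_conv_all_nth in_set_conv_nth)
            (metis less_imp_le nth_mem)
        have "m \<le> m'" using m' hb ms by (auto simp: ltr_min_shape_def sorted_wrt_append)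
        then have "m < x" using y m' by simp
        then show ?thesis using hb ms Bs len by (auto simp: ltr_min_shape_def list_all2_append)
      qed
      ultimately show ?thesis by blast
    qed
  qed
  then show ?thesis using ltr_min_decomp_unique[OF assms(2)] assms(1) by metis
qed

text \<open>
  Induction on the first block.  An occurrence either lives in the later part of the word, up to
  exchanging its first letter, or it yields a
  \<open>213\<close> in the first block \<open>B\<close> or an ascent from \<open>B\<close> to a later letter, which then belongs to a
  later block because later minima are smaller than \<open>m\<close>.
\<close>

lemma four_letters_iff_blocks:
  assumes "ltr_min_shape ms Bs" "distinct (concat (map2 (#) ms Bs))"
  shows "(\<exists>x y z w. subseq [x, y, z, w] (concat (map2 (#) ms Bs)) \<and> x < y \<and> z < y \<and> y < w) \<longleftrightarrow>
     (\<exists>B\<in>set Bs. contains B [2, 1, 3]) \<or> \<not> blocks_decreasing Bs"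
  using assms
proof (induction rule: ltr_min_shape_induct)
  case Nil
  then show ?case by (simp add: blocks_decreasing_def)
next
  case (Cons m B ms Bs)
  let ?rest = "concat (map2 (#) ms Bs)"
  let ?bad = "\<lambda>xs. \<exists>x y z w. subseq [x, y, z, w] xs \<and> x < y \<and> z < y \<and> y < (w::nat)"
  have len: "length ms = length Bs"
    using Cons.hyps by (auto simp: ltr_min_shape_def dest: list_all2_lengthD)
  note set_rest = set_concat_map2_Cons[OF len]
  have rest: "?rest = [] \<or> (\<exists>k r. ?rest = k # r \<and> k < m)"
    using Cons.hyps len by (cases ms; cases Bs) auto
  have later: "(\<exists>v\<in>set ?rest. u < v) \<longleftrightarrow> (\<exists>C\<in>set Bs. \<exists>v\<in>set C. \<not> u > v)" if "u \<in> set B" for u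
  proof
    assume "\<exists>v\<in>set ?rest. u < v"
    then show "\<exists>C\<in>set Bs. \<exists>v\<in>set C. \<not> u > v" using set_rest that Cons.hyps
      by (metis UN_E UnE less_asym less_trans)
  next
    assume "\<exists>C\<in>set Bs. \<exists>v\<in>set C. \<not> u > v"
    then obtain C v where v: "C \<in> set Bs" "v \<in> set C" "\<not> u > v" by blast
    then have "v \<in> set ?rest" using set_rest by blast
    moreover have "set B \<inter> set ?rest = {}"
    proof -
      have "distinct (B @ ?rest)" using Cons.prems by simp
      then show ?thesis unfolding distinct_append by blast
    qed
    then have "u \<noteq> v" using \<open>v \<in> set ?rest\<close> that by blast
    ultimately show "\<exists>v\<in>set ?rest. u < v" using v by (metis linorder_neqE_nat)
  qed
  have "?bad ((m # B) @ ?rest) \<longleftrightarrow>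
    contains B [2, 1, 3] \<or> (\<exists>u\<in>set B. \<exists>v\<in>set ?rest. u < v) \<or> ?bad ?rest"
  proof
    assume "?bad ((m # B) @ ?rest)"
    then obtain x y z w where s: "subseq [x, y, z, w] ((m # B) @ ?rest)"
      and less: "x < y" "z < y" "y < w" by blast
    have in_B: "subseq [y, z, w] B" if "subseq [x, y, z, w] (m # B)"
      using that unfolding subseq4_Cons by (blast dest: subseq_Cons')
    have y_B: "y \<in> set B" if "subseq [x, y] (m # B)"
      using that subseq_Cons'[of x "[y]" B] unfolding subseq2_Cons subseq_singleton_left by blast
    have init_B: "subseq [x, y] (m # B)" if "subseq [x, y, z] (m # B)"
      using subseq_append_leftD[of "[x, y]" "[z]"] that unfolding append.simps by blast
    have last_rest: "w \<in> set ?rest" if "subseq [z, w] ?rest"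
      using subseq_Cons'[OF that] by (simp add: subseq_singleton_left)
    from s consider
        "subseq [x, y, z, w] ?rest"
      | "x \<in> set (m # B)" "subseq [y, z, w] ?rest"
      | "subseq [x, y] (m # B)" "w \<in> set ?rest"
      | "subseq [y, z, w] B"
      using in_B init_B last_rest unfolding subseq4_append by blast
    then show "contains B [2, 1, 3] \<or> (\<exists>u\<in>set B. \<exists>v\<in>set ?rest. u < v) \<or> ?bad ?rest"
    proof cases
      case 1
      then show ?thesis using less by blast
    next
      case 2
      then obtain k r where k: "?rest = k # r" "k < m" using rest by fastforce
      \<comment> \<open>The first later minimum k replaces x, moving the whole occurrence behind B.\<close>
      have "k < y" using k(2) 2(1) Cons.hyps less by auto
      moreover have "subseq [k, y, z, w] ?rest"
        using 2(2) \<open>k < y\<close> unfolding k(1) by auto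
      ultimately have "?bad ?rest" using less by blast
      then show ?thesis by (intro disjI2)
    next
      case 3
      then have "\<exists>u\<in>set B. \<exists>v\<in>set ?rest. u < v" using y_B less by blast
      then show ?thesis by (intro disjI2 disjI1)
    next
      case 4
      then have "contains B [2, 1, 3]" unfolding contains_213 using less by blast
      then show ?thesis by (rule disjI1)
    qed
  next
    assume "contains B [2, 1, 3] \<or> (\<exists>u\<in>set B. \<exists>v\<in>set ?rest. u < v) \<or> ?bad ?rest"
    then show "?bad ((m # B) @ ?rest)"
    proof (elim disjE)
      assume "contains B [2, 1, 3]"
      then obtain b a c where 1: "subseq [b, a, c] B" "a < b" "b < c"
        unfolding contains_213 by blast
      have "b \<in> set B"
        using subseq_append_leftD[of "[b]" "[a, c]" B] 1(1) by (simp add: subseq_singleton_left)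
      then have "m < b" using Cons.hyps by blast
      moreover have "subseq [m, b, a, c] ((m # B) @ ?rest)"
        unfolding subseq4_append subseq4_Cons using 1(1) by blast
      ultimately show ?thesis using 1 by blast
    next
      assume "\<exists>u\<in>set B. \<exists>v\<in>set ?rest. u < v"
      then obtain u v where 2: "u \<in> set B" "v \<in> set ?rest" "u < v" by blast
      then obtain k r where k: "?rest = k # r" "k < m" using rest by fastforce
      have "m < u" using 2 Cons.hyps by blast
      then have "v \<in> set r" using 2 k by auto
      \<comment> \<open>The word after B starts with a minimum k < m < u, which stands before v.\<close>
      then have "subseq [m, u, k, v] ((m # B) @ ?rest)"
        unfolding subseq4_append subseq2_Cons k(1) using 2(1) by blast
      then show ?thesis using k(2) 2(3) \<open>m < u\<close> less_trans by blast
    next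
      assume "?bad ?rest"
      then obtain x y z w where 3: "subseq [x, y, z, w] ?rest" "x < y" "z < y" "y < w" by blast
      have "subseq [x, y, z, w] ((m # B) @ ?rest)" unfolding subseq4_append using 3(1) by blast
      then show ?thesis using 3 by blast
    qed
  qed
  moreover have "blocks_decreasing (B # Bs) \<longleftrightarrow>
      (\<forall>u\<in>set B. \<not> (\<exists>v\<in>set ?rest. u < v)) \<and> blocks_decreasing Bs"
    using later by (auto simp: blocks_decreasing_iff_sorted_wrt block_gt_def)
  ultimately show ?case using Cons by auto
qed


section \<open>The output of the \<open>{132, 231}\<close>-stack\<close>

text \<open>
  A decreasing word followed by an increasing one has no interior peak.
\<close>

lemma not_contains_132_231_if_valley:
  assumes "sorted_wrt (>) D" "sorted_wrt (<) I" "distinct (D @ I)"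
  shows "\<not> (contains (D @ I) [1, 3, 2] \<or> contains (D @ I) [2, 3, 1])"
proof -
  have "b < a" if "subseq [a, b] D" for a b
    using that assms(1) by (simp add: sorted_wrt_iff_subseq)
  moreover have "a < b" if "subseq [a, b] I" for a b
    using that assms(2) by (simp add: sorted_wrt_iff_subseq)
  moreover have "subseq [a, b] D" if "subseq [a, b, c] D" for a b c
    using that subseq_append_leftD[of "[a, b]" "[c]"] by simp
  moreover have "subseq [b, c] I" if "subseq [a, b, c] I" for a b c
    using that by (metis subseq_Cons')
  ultimately show ?thesis
    unfolding contains_132_or_231[OF assms(3)] subseq3_append by (meson less_asym)
qed

lemma stack_run_pop:
  assumes "distinct (x # y # s)" "subseq [a, b, c] (x # y # s)" "a < b" "c < b"
  shows "stack_run {[1, 3, 2], [2, 3, 1]} (x # xs) (y # s) =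
     y # stack_run {[1, 3, 2], [2, 3, 1]} (x # xs) s"
proof -
  have "contains (x # y # s) [1, 3, 2] \<or> contains (x # y # s) [2, 3, 1]"
    unfolding contains_132_or_231[OF assms(1)] using assms by blast
  then show ?thesis by auto
qed

lemma stack_run_push:
  assumes "sorted_wrt (>) D" "sorted_wrt (<) I" "distinct (D @ I)" "D @ I = x # s"
  shows "stack_run {[1, 3, 2], [2, 3, 1]} (x # xs) s =
     stack_run {[1, 3, 2], [2, 3, 1]} xs (x # s)"
  using not_contains_132_231_if_valley[OF assms(1-3)] unfolding assms(4)
  by (cases s) auto

text \<open>
  The stack is split into the letters \<open>S\<close> of the current block and the minima \<open>m # M\<close>.  A letter
  \<open>x\<close> of the block pops \<open>y\<close> if and only if \<open>x < y\<close>: in this case \<open>x y m\<close> is a peak, and otherwise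
  \<open>x # y # S\<close> still decreases.  The condition on \<open>rest\<close> makes the run of the \<open>12\<close>-stack complete:
  the end of the input empties \<open>S\<close>, and so does a new minimum \<open>x\<close>, as \<open>x y m\<close> is a peak for each
  \<open>y\<close> in \<open>S\<close>.
\<close>

lemma stack_run_block:
  assumes "sorted_wrt (>) S" "sorted_wrt (<) (m # M)" "\<forall>x\<in>set (S @ B). m < x"
    "distinct (B @ S @ m # M)" "rest = [] \<or> hd rest < m"
  shows "stack_run {[1, 3, 2], [2, 3, 1]} (B @ rest) (S @ m # M) =
     order_stack (>) B S @ stack_run {[1, 3, 2], [2, 3, 1]} rest (m # M)"
  using assms
proof (induction "(>) :: nat \<Rightarrow> nat \<Rightarrow> bool" B S rule: order_stack.induct)
  case (1 S)
  show ?case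
  proof (cases rest)
    case Nil
    then show ?thesis by simp
  next
    case rest: (Cons x xs)
    have "stack_run {[1, 3, 2], [2, 3, 1]} (x # xs) (T @ m # M) =
        T @ stack_run {[1, 3, 2], [2, 3, 1]} (x # xs) (m # M)"
      if "\<forall>y\<in>set T. m < y" "distinct (T @ m # M)" for T
      using that
    proof (induction T)
      case (Cons y T)
      have less: "x < m" "m < y" using rest 1 Cons by auto
      have "x \<noteq> z" if "z \<in> set (y # T @ m # M)" for z
        using that less Cons.prems 1 by auto
      then have "distinct (x # y # T @ m # M)" using Cons.prems by auto
      moreover have "subseq [x, y, m] (x # y # T @ m # M)"
        by (simp add: subseq_singleton_left)
      ultimately show ?case
        using stack_run_pop[of x y "T @ m # M" x y m xs] less Cons
        by (simp del: stack_run.simps)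
    qed simp
    then show ?thesis using 1 rest by simp
  qed
next
  case (2 x xs)
  then show ?case
    using stack_run_push[of "[x]" "m # M" x "m # M" "xs @ rest"]
    by (simp del: stack_run.simps)
next
  case (3 x xs y S)
  show ?case
  proof (cases "x < y")
    case True
    have "subseq [x, y, m] (x # y # S @ m # M)"
      by (simp add: subseq_singleton_left)
    then show ?thesis
      using stack_run_pop[of x y "S @ m # M" x y m "xs @ rest"] 3 True
      by (simp del: stack_run.simps)
  next
    case False
    then have "sorted_wrt (>) (x # y # S)" using 3 by auto
    then show ?thesis
      using stack_run_push[of "x # y # S" "m # M" x "y # S @ m # M" "xs @ rest"] 3 False
      by (auto simp del: stack_run.simps)
  qed
qed

text \<open>
  Here \<open>M\<close> holds the minima of the blocks that have already been processed.  Each block is output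
  before the next minimum is pushed, so at the start of a block the stack holds minima only.
\<close>

lemma stack_run_concat_blocks:
  assumes "ltr_min_shape ms Bs" "sorted_wrt (<) (rev ms @ M)" "distinct (concat (map2 (#) ms Bs) @ M)"
  shows "stack_run {[1, 3, 2], [2, 3, 1]} (concat (map2 (#) ms Bs)) M =
     concat (map (\<lambda>B. order_stack (>) B []) Bs) @ rev ms @ M"
  using assms
proof (induction arbitrary: M rule: ltr_min_shape_induct)
  case (Cons m B ms Bs)
  let ?\<Sigma> = "{[1, 3, 2], [2, 3, 1::nat]}"
  define rest where "rest = concat (map2 (#) ms Bs)"
  have srt: "sorted_wrt (<) (m # M)" using Cons.prems by (simp add: sorted_wrt_append)
  have dist: "distinct (m # B @ rest @ M)" using Cons.prems(2) by (simp add: rest_def)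
  have "stack_run ?\<Sigma> (m # B @ rest) M = stack_run ?\<Sigma> (B @ rest) (m # M)"
    using srt dist by (intro stack_run_push[of "[]" "m # M"]) auto
  also have "\<dots> = order_stack (>) B [] @ stack_run ?\<Sigma> rest (m # M)"
  proof -
    have "rest = [] \<or> hd rest < m"
      unfolding rest_def using Cons.hyps by (cases ms; cases Bs) (auto simp: ltr_min_shape_def)
    moreover have "distinct (B @ [] @ m # M)" using dist by auto
    ultimately show ?thesis
      using stack_run_block[of "[]" m M B rest] srt Cons.hyps by simp
  qed
  also have "stack_run ?\<Sigma> rest (m # M) =
      concat (map (\<lambda>B. order_stack (>) B []) Bs) @ rev ms @ m # M"
    unfolding rest_def using Cons.prems(1) dist by (intro Cons.IH) (auto simp: rest_def)
  finally show ?case by (simp add: rest_def)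
qed simp


section \<open>The equivalences\<close>

lemma sortable_iff_output_avoids_231:
  assumes "\<pi> \<in> perms" "mset (stack_output \<Sigma> \<pi>) = mset \<pi>"
  shows "sortable \<Sigma> \<pi> \<longleftrightarrow> (\<nexists>b c a. subseq [b, c, a] (stack_output \<Sigma> \<pi>) \<and> a < b \<and> b < c)"
proof -
  let ?out = "stack_output \<Sigma> \<pi>"
  obtain n where "\<pi> \<in> permutations_of_set {1..n}" using assms(1) by (auto simp: perms_def)
  then have \<pi>: "set \<pi> = {1..n}" "distinct \<pi>" by (auto simp: permutations_of_set_def)
  then have n: "length \<pi> = n" using distinct_card by fastforce
  have dist: "distinct ?out" using assms(2) \<pi>(2) mset_eq_imp_distinct_iff by blast
  have "set (stack_output {[2, 1]} ?out) = {1..n}"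
    using \<pi>(1) mset_eq_setD[OF assms(2)] by (simp only: stack_output_21[OF dist] set_order_stack) simp
  moreover have "set [1..<Suc n] = {1..n}" by auto
  ultimately have "stack_output {[2, 1]} ?out = [1..<Suc n] \<longleftrightarrow>
      sorted_wrt (<) (stack_output {[2, 1]} ?out)"
    by (metis strict_sorted_equal sorted_wrt_upt)
  then show ?thesis unfolding sortable_def n stack_output_21_sorted_iff[OF dist] .
qed

text \<open>
  The output is \<open>?W @ rev ms\<close>, and it avoids \<open>231\<close> if and only if \<open>?W\<close> decreases: an ascent in
  \<open>?W\<close> is completed by the minimum of the block that contains its lower letter, and without an
  ascent in \<open>?W\<close> the last two letters of an occurrence would form a descent in \<open>rev ms\<close>.
\<close>

lemma sortable_iff_blocks:
  assumes "\<pi> \<in> perms" "ltr_min_decomp \<pi> ms Bs"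
  shows "sortable {[1, 3, 2], [2, 3, 1]} \<pi> \<longleftrightarrow>
     (\<forall>B\<in>set Bs. avoids B [2, 1, 3]) \<and> blocks_decreasing Bs"
proof -
  let ?W = "concat (map (\<lambda>B. order_stack (>) B []) Bs)"
  have dist: "distinct \<pi>" using assms(1) by (auto simp: perms_def permutations_of_set_def)
  have hb: "ltr_min_shape ms Bs" using ltr_min_shape_if_ltr_min_decomp assms(2) dist by blast
  have \<pi>: "\<pi> = concat (map2 (#) ms Bs)" "length ms = length Bs"
    using assms(2) unfolding ltr_min_decomp_def by metis+
  have inc: "sorted_wrt (<) (rev ms)" using hb by (simp add: ltr_min_shape_def sorted_wrt_rev)
  have out: "stack_output {[1, 3, 2], [2, 3, 1]} \<pi> = ?W @ rev ms"
    using stack_run_concat_blocks[OF hb, of "[]"] inc dist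
    unfolding stack_output_def \<pi>(1) append_Nil2 by blast
  have "mset (concat (map (\<lambda>B. order_stack (>) B []) Bs)) = mset (concat Bs)" for Bs :: "nat list list"
    by (induction Bs) (auto simp: mset_order_stack)
  moreover have "mset (concat (map2 (#) ms Bs)) = mset (concat Bs) + mset ms"
    using \<pi>(2) by (induction ms Bs rule: list_induct2) auto
  ultimately have mset_out: "mset (?W @ rev ms) = mset \<pi>" using \<pi> by simp
  then have dist_out: "distinct (?W @ rev ms)" using dist mset_eq_imp_distinct_iff by blast
  have set_W: "set ?W = (\<Union>B\<in>set Bs. set B)" by (auto simp: set_order_stack)
  have "sortable {[1, 3, 2], [2, 3, 1]} \<pi> \<longleftrightarrow>
      (\<nexists>b c a. subseq [b, c, a] (?W @ rev ms) \<and> a < b \<and> b < c)"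
    using sortable_iff_output_avoids_231[OF assms(1), of "{[1, 3, 2], [2, 3, 1]}"] mset_out
    unfolding out by blast
  also have "\<dots> \<longleftrightarrow> sorted_wrt (>) ?W"
  proof
    assume no: "\<nexists>b c a. subseq [b, c, a] (?W @ rev ms) \<and> a < b \<and> b < c"
    show "sorted_wrt (>) ?W" unfolding sorted_wrt_iff_subseq
    proof (intro allI impI)
      fix b c assume bc: "subseq [b, c] ?W"
      then have "b \<in> set ?W"
        using subseq_append_leftD[of "[b]" "[c]" ?W] unfolding append.simps subseq_singleton_left by blast
      then obtain i where i: "i < length Bs" "b \<in> set (Bs ! i)"
        unfolding set_W by (metis UN_E in_set_conv_nth)
      then have m: "ms ! i < b" "ms ! i \<in> set ms"
        using hb \<pi>(2) unfolding ltr_min_shape_def list_all2_conv_all_nth by simp_all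
      then have "subseq [b, c, ms ! i] (?W @ rev ms)"
        using bc unfolding subseq3_append set_rev by blast
      then have "\<not> b < c" using no m by blast
      moreover have "b \<noteq> c"
        using distinct_if_subseq[OF bc] dist_out unfolding distinct_append by simp
      ultimately show "b > c" by simp
    qed
  next
    assume dec: "sorted_wrt (>) ?W"
    have "\<not> b < c \<or> \<not> a < b" if "subseq [b, c, a] (?W @ rev ms)" for a b c
    proof (cases "subseq [b, c] ?W")
      case True
      then have "c < b" using dec unfolding sorted_wrt_iff_subseq by blast
      then show ?thesis by simp
    next
      case False
      then have "subseq [c, a] (rev ms)"
        using that subseq_append_leftD[of "[b, c]" "[a]" ?W] subseq_Cons'[of b "[c, a]" "rev ms"]
        unfolding subseq3_append append.simps by blast
      then have "c < a" using inc unfolding sorted_wrt_iff_subseq by blast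
      then show ?thesis by simp
    qed
    then show "\<nexists>b c a. subseq [b, c, a] (?W @ rev ms) \<and> a < b \<and> b < c" by blast
  qed
  also have "\<dots> \<longleftrightarrow> (\<forall>B\<in>set Bs. avoids B [2, 1, 3]) \<and> blocks_decreasing Bs"
  proof -
    have "distinct B" if "B \<in> set Bs" for B
    proof -
      have "distinct (order_stack (>) B [])"
        using that dist_out unfolding distinct_append distinct_concat_iff by auto
      then show ?thesis using mset_order_stack[of "(>)" B "[]"]
        by (metis add_cancel_right_right mset.simps(1) mset_eq_imp_distinct_iff)
    qed
    then have "(\<forall>B\<in>set Bs. sorted_wrt (>) (order_stack (>) B [])) \<longleftrightarrow>
        (\<forall>B\<in>set Bs. avoids B [2, 1, 3])"
      using order_stack_decreasing_iff by blast
    then show ?thesis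
      by (simp add: sorted_wrt_concat sorted_wrt_map set_order_stack
        blocks_decreasing_iff_sorted_wrt block_gt_def[abs_def])
  qed
  finally show ?thesis .
qed

lemma avoiding_iff_blocks:
  assumes "\<pi> \<in> perms" "ltr_min_decomp \<pi> ms Bs"
  shows "\<pi> \<in> Av {[1, 3, 2, 4], [2, 3, 1, 4]} \<longleftrightarrow>
     (\<forall>B\<in>set Bs. avoids B [2, 1, 3]) \<and> blocks_decreasing Bs"
proof -
  have dist: "distinct \<pi>" using assms(1) by (auto simp: perms_def permutations_of_set_def)
  have hb: "ltr_min_shape ms Bs" using ltr_min_shape_if_ltr_min_decomp assms(2) dist by blast
  have \<pi>: "\<pi> = concat (map2 (#) ms Bs)" using assms(2) unfolding ltr_min_decomp_def by metis
  have "\<pi> \<in> Av {[1, 3, 2, 4], [2, 3, 1, 4]} \<longleftrightarrow>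
      \<not> (contains \<pi> [1, 3, 2, 4] \<or> contains \<pi> [2, 3, 1, 4])"
    using assms(1) by (simp add: Av_def)
  also have "\<dots> \<longleftrightarrow> \<not> ((\<exists>B\<in>set Bs. contains B [2, 1, 3]) \<or> \<not> blocks_decreasing Bs)"
    unfolding contains_1324_or_2314[OF dist] four_letters_iff_blocks[OF hb, folded \<pi>, OF dist] ..
  finally show ?thesis by blast
qed

theorem corollary6p4:
  shows "(\<forall>\<pi> ms Bs. \<pi> \<in> perms \<and> ltr_min_decomp \<pi> ms Bs \<longrightarrow>
            (((\<forall>B\<in>set Bs. avoids B [2,1,3]) \<and> blocks_decreasing Bs)
               \<longleftrightarrow> sortable {[1,3,2], [2,3,1]} \<pi>) \<and>
            (sortable {[1,3,2], [2,3,1]} \<pi> \<longleftrightarrow> \<pi> \<in> Av {[1,3,2,4], [2,3,1,4]}))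
         \<and> Sort [1,3,2] [2,3,1] = Av {[1,3,2,4], [2,3,1,4]}"
proof -
  have equiv: "((\<forall>B\<in>set Bs. avoids B [2,1,3]) \<and> blocks_decreasing Bs
        \<longleftrightarrow> sortable {[1,3,2], [2,3,1]} \<pi>) \<and>
      (sortable {[1,3,2], [2,3,1]} \<pi> \<longleftrightarrow> \<pi> \<in> Av {[1,3,2,4], [2,3,1,4]})"
    if "\<pi> \<in> perms" "ltr_min_decomp \<pi> ms Bs" for \<pi> ms Bs
    using sortable_iff_blocks[OF that] avoiding_iff_blocks[OF that] by blast
  have "Sort [1,3,2] [2,3,1] = Av {[1,3,2,4], [2,3,1,4]}"
    using equiv ltr_min_decomp_exists unfolding Sort_def Av_def by blast
  then show ?thesis using equiv by blast
qed

end
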